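(* Let $G,H$ be simple undirected graphs with vertex set $V=\{1,\dots,n\}$ and let $k\ge1$. Then $\mathcal Q^{k+1}_{G,H}\subseteq\mathcal T^k_{G,H}\subseteq\mathcal Q^k_{G,H}$ and $\mathcal Q^{k+1}_{G}\subseteq\mathcal T^k_{G}\subseteq\mathcal Q^k_{G}$.
   Context: $E_G$ is the edge set of $G$, $A_G$ its adjacency matrix, $\delta_G(a)$ the set of neighbours of $a$, and $e$ the all-ones vector. $$\mathcal T_{G,H}=\{X\in[0,1]^{n\times n}: A_GX=XA_H,\ Xe=X^Te=e\},$$ where $A_GX=XA_H$ reads $\sum_{w\in\delta_H(v)}X_{uw}-\sum_{w\in\delta_G(u)}X_{wv}=0$ for all $u,v\in V$. $\mathcal Q_{G,H}$ is the set of $X\in[0,1]^{n\times n}$ with $Xe=X^Te=e$, $X_{u_1v_1}X_{u_2v_2}=0$ for all $\{u_1,u_2\}\in E_G,\{v_1,v_2\}\notin E_H$, and $X_{u_1v_1}X_{u_2v_2}=0$ for all $\{u_1,u_2\}\notin E_G$, $\{v_1,v_2\}\in E_H$ (here $u_1=u_2$ counts as $\{u_1,u_2\}\notin E_G$, and $v_1=v_2$ as $\{v_1,v_2\}\notin E_H$). $\mathcal T_G=\mathcal T_{G,G}$ and $\mathcal Q_G=\mathcal Q_{G,G}$. **Sherali-Adams relaxations.** For $P=\{x\in[0,1]^N: f_j(x)=0\ (1\le j\le s),\ g_j(x)\ge 0\ (1\le j\le t)\}$ with polynomials $f_j,g_j$, the $k$th Sherali-Adams relaxation $P^k$ is obtained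 as follows. Form the constraints $\prod_{i\in I}x_i\, f_j(x)=0$ for all $I\subseteq\{1,\dots,N\}$, $|I|\le k-1$ and all $j$; $\prod_{i\in I}x_i\prod_{i\in J\setminus I}(1-x_i)\,g_j(x)\ge0$ for all $I\subseteq J$, $|J|\le k-1$ and all $j$; and $\prod_{i\in I}x_i\prod_{i\in J\setminus I}(1-x_i)\ge 0$ for all $I\subseteq J$, $|J|\le k$. Expand, replace every $x_i^2$ by $x_i$ repeatedly until all monomials are square-free, and replace each monomial $\prod_{i\in I}x_i$ with $|I|\ge 1$ by a new variable $y_I$ (and the empty monomial by $1$). This gives a polyhedron $\hat P^k$ in $y$-space, and $P^k=\{x: x_i=y_{\{i\}}\ \forall i,\ y\in\hat P^k\}$. The $f_j$ are the row-sum and column-sum equations together with the entries of $A_GX-XA_H$ (for $\mathcal T_{G,H}$) or the quadratic equations (for $\mathcal Q_{G,H}$); there are no $g_j$. $\mathcal T^k_{G,H},\mathcal T^k_G,\mathcal Q^k_{G,H},\mathcal Q^k_G$ denote the $k$th relaxations. *)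

theory Defs
  imports "HOL-Analysis.Analysis" "HOL-Library.Poly_Mapping"
begin

section \<open>Sherali-Adams relaxations\<close>

text \<open>A polynomial is a finitely supported map from monomials to coefficients, a monomial a
  finitely supported map from variables to exponents.\<close>

type_synonym 'v mpoly = "('v \<Rightarrow>\<^sub>0 nat) \<Rightarrow>\<^sub>0 real"

definition Var :: "'v \<Rightarrow> 'v mpoly" where
  "Var i = Poly_Mapping.single (Poly_Mapping.single i 1) 1"

text \<open>Exhaustively replacing squares \<open>x\<^sub>i\<^sup>2\<close> by \<open>x\<^sub>i\<close> turns a monomial \<open>m\<close> into the product of the
  variables in its support \<open>keys m\<close>, which is then replaced by \<open>y\<^sub>I\<close> with \<open>I = keys m\<close>, or by \<open>1\<close>
  if \<open>I\<close> is empty. The value of \<open>y\<close> at the empty set is never used.\<close>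

definition linearize :: "('v set \<Rightarrow> real) \<Rightarrow> 'v mpoly \<Rightarrow> real" where
  "linearize y p =
     (\<Sum>m\<in>Poly_Mapping.keys p. Poly_Mapping.lookup p m *
        (if Poly_Mapping.keys m = {} then 1 else y (Poly_Mapping.keys m)))"

definition SA_factor :: "'v set \<Rightarrow> 'v set \<Rightarrow> 'v mpoly" where
  "SA_factor I J = (\<Prod>i\<in>I. Var i) * (\<Prod>i\<in>J - I. 1 - Var i)"

text \<open>In the following, \<open>F\<close> is the set of the polynomials \<open>f\<^sub>j\<close> (constraints \<open>f\<^sub>j = 0\<close>) and \<open>P\<close> the
  set of the polynomials \<open>g\<^sub>j\<close> (constraints \<open>g\<^sub>j \<ge> 0\<close>); the variables are indexed by a finite type.
  The relaxations are only meant for \<open>k \<ge> 1\<close>.\<close>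

definition SA_polyhedron ::
  "('v::finite) mpoly set \<Rightarrow> 'v mpoly set \<Rightarrow> nat \<Rightarrow> ('v set \<Rightarrow> real) set" where
  "SA_polyhedron F P k =
     {y. (\<forall>f\<in>F. \<forall>I. card I \<le> k - 1 \<longrightarrow> linearize y ((\<Prod>i\<in>I. Var i) * f) = 0) \<and>
         (\<forall>g\<in>P. \<forall>I J. I \<subseteq> J \<and> card J \<le> k - 1 \<longrightarrow> linearize y (SA_factor I J * g) \<ge> 0) \<and>
         (\<forall>I J. I \<subseteq> J \<and> card J \<le> k \<longrightarrow> linearize y (SA_factor I J) \<ge> 0)}"

definition SA_relaxation ::
  "('v::finite) mpoly set \<Rightarrow> 'v mpoly set \<Rightarrow> nat \<Rightarrow> (real ^ 'v) set" where
  "SA_relaxation F P k = {x. \<exists>y\<in>SA_polyhedron F P k. \<forall>i. x $ i = y {i}}"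


section \<open>Graphs and the two polynomial systems\<close>

text \<open>A graph on the vertex set \<open>UNIV :: 'n set\<close> is given by its set of edges \<open>{u, v}\<close>.\<close>

definition simple_graph :: "'n set set \<Rightarrow> bool" where
  "simple_graph E \<longleftrightarrow> (\<forall>e\<in>E. \<exists>u v. u \<noteq> v \<and> e = {u, v})"

definition adj_matrix :: "('n::finite) set set \<Rightarrow> 'a::zero_neq_one ^ 'n ^ 'n" where
  "adj_matrix E = (\<chi> u v. if {u, v} \<in> E then 1 else 0)"

text \<open>The matrix of indeterminates, whose \<open>(u, v)\<close> entry is the variable \<open>X\<^sub>u\<^sub>v\<close>.\<close>

definition XX :: "(('n::finite) \<times> 'n) mpoly ^ 'n ^ 'n" where
  "XX = (\<chi> u v. Var (u, v))"

definition doubly_stochastic_eqs :: "(('n::finite) \<times> 'n) mpoly set" where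
  "doubly_stochastic_eqs =
     (\<Union>u. {(XX *v vec 1) $ u - 1, (transpose XX *v vec 1) $ u - 1})"

definition T_eqs :: "('n::finite) set set \<Rightarrow> 'n set set \<Rightarrow> ('n \<times> 'n) mpoly set" where
  "T_eqs G H = doubly_stochastic_eqs \<union>
     {(adj_matrix G ** XX - XX ** adj_matrix H) $ u $ v | u v. True}"

definition Q_eqs :: "('n::finite) set set \<Rightarrow> 'n set set \<Rightarrow> ('n \<times> 'n) mpoly set" where
  "Q_eqs G H = doubly_stochastic_eqs \<union>
     {XX $ u1 $ v1 * XX $ u2 $ v2 | u1 v1 u2 v2. {u1, u2} \<in> G \<and> {v1, v2} \<notin> H} \<union>
     {XX $ u1 $ v1 * XX $ u2 $ v2 | u1 v1 u2 v2. {u1, u2} \<notin> G \<and> {v1, v2} \<in> H}"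

definition flatten :: "real ^ 'n ^ 'n \<Rightarrow> real ^ ('n \<times> 'n)" where
  "flatten X = (\<chi> p. X $ fst p $ snd p)"

definition T_relaxation ::
  "nat \<Rightarrow> ('n::finite) set set \<Rightarrow> 'n set set \<Rightarrow> (real ^ 'n ^ 'n) set" where
  "T_relaxation k G H = {X. flatten X \<in> SA_relaxation (T_eqs G H) {} k}"

definition Q_relaxation ::
  "nat \<Rightarrow> ('n::finite) set set \<Rightarrow> 'n set set \<Rightarrow> (real ^ 'n ^ 'n) set" where
  "Q_relaxation k G H = {X. flatten X \<in> SA_relaxation (Q_eqs G H) {} k}"

end

theory Submission imports Defs begin

text \<open>Write \<open>z I\<close> for the linearized monomial \<open>x\<^sub>I\<close>. For \<open>Q\<^sup>k\<^sup>+\<^sup>1 \<subseteq> T\<^sup>k\<close>, expand each summand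
  \<open>z (I \<union> {wv})\<close> of an adjacency constraint by the row equation of \<open>u\<close>, and each summand \<open>z (I \<union> {uw})\<close>
  by the column equation of \<open>v\<close>; by the quadratic equations both sides become the same double sum.
  For \<open>T\<^sup>k \<subseteq> Q\<^sup>k\<close>, monomials of degree \<open>k + 1\<close> are unconstrained in \<open>T\<^sup>k\<close> and are set to \<open>0\<close>. In smaller
  degree, the row and column equations and nonnegativity kill every monomial with two entries in
  one line; if \<open>u\<^sub>1v\<^sub>1 \<in> I\<close>, the adjacency constraint at \<open>(u\<^sub>1, v\<^sub>2)\<close> or \<open>(u\<^sub>2, v\<^sub>1)\<close> then has one side equal
  to \<open>0\<close>, so that by nonnegativity all summands of the other side vanish.\<close>

section \<open>Linearization\<close>

text \<open>The empty monomial gets the value 1 whatever \<open>y {}\<close> is, so degree 0 needs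
  no separate treatment in the constraints below.\<close>

definition lin_mon :: "('v set \<Rightarrow> real) \<Rightarrow> 'v set \<Rightarrow> real" where
  "lin_mon y I = (if I = {} then 1 else y I)"

text \<open>Monomials outside the support have coefficient 0. Polynomials with different supports
  can thus share one index set, which gives additivity.\<close>

lemma linearize_superset:
  assumes "finite S" "Poly_Mapping.keys p \<subseteq> S"
  shows "linearize y p = (\<Sum>m\<in>S. Poly_Mapping.lookup p m * lin_mon y (Poly_Mapping.keys m))"
  unfolding linearize_def lin_mon_def
  by (rule sum.mono_neutral_left) (use assms in \<open>auto simp: in_keys_iff\<close>)

lemma linearize_0 [simp]: "linearize y 0 = 0"
  by (simp add: linearize_def)

lemma linearize_single:
  "linearize y (Poly_Mapping.single m c) = c * lin_mon y (Poly_Mapping.keys m)"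
  by (subst linearize_superset[of "{m}"]) auto

lemma linearize_add: "linearize y (p + q) = linearize y p + linearize y q"
proof -
  let ?S = "Poly_Mapping.keys p \<union> Poly_Mapping.keys q"
  have "linearize y r = (\<Sum>m\<in>?S. Poly_Mapping.lookup r m * lin_mon y (Poly_Mapping.keys m))"
    if "Poly_Mapping.keys r \<subseteq> ?S" for r
    by (rule linearize_superset) (use that in auto)
  then show ?thesis
    using Poly_Mapping.keys_add[of p q]
    by (simp add: lookup_add algebra_simps sum.distrib)
qed

lemma linearize_diff: "linearize y (p - q) = linearize y p - linearize y q"
  using linearize_add[of y "p - q" q] by simp

lemma linearize_sum: "linearize y (sum f A) = (\<Sum>a\<in>A. linearize y (f a))"
  by (induction A rule: infinite_finite_induct) (auto simp: linearize_add)

lemma linearize_cong: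
  assumes "\<And>m. m \<in> Poly_Mapping.keys p \<Longrightarrow> y (Poly_Mapping.keys m) = y' (Poly_Mapping.keys m)"
  shows "linearize y p = linearize y' p"
  unfolding linearize_def by (rule sum.cong) (auto simp: assms)

text \<open>Exponents in \<open>nat\<close> cannot cancel, so equality holds and not just inclusion.
  Under linearization, multiplying monomials becomes uniting their supports.\<close>

lemma keys_add_nat:
  fixes a b :: "'v \<Rightarrow>\<^sub>0 nat"
  shows "Poly_Mapping.keys (a + b) = Poly_Mapping.keys a \<union> Poly_Mapping.keys b"
  by (auto simp: in_keys_iff lookup_add)

lemma keys_sum_single:
  "finite I \<Longrightarrow> Poly_Mapping.keys (\<Sum>i\<in>I. Poly_Mapping.single i (1::nat)) = I"
  by (induction I rule: finite_induct) (auto simp: keys_add_nat)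

lemma prod_Var:
  "(\<Prod>i\<in>I. Var i) = Poly_Mapping.single (\<Sum>i\<in>I. Poly_Mapping.single i 1) 1"
  by (induction I rule: infinite_finite_induct) (auto simp: Var_def mult_single)

lemma linearize_prod_Var:
  fixes I :: "'v::finite set"
  shows "linearize y (\<Prod>i\<in>I. Var i) = lin_mon y I"
  by (simp add: prod_Var linearize_single keys_sum_single del: One_nat_def)

text \<open>The case \<open>p \<in> I\<close> is included: the square of the variable is reduced,
  and \<open>insert p I\<close> is \<open>I\<close>.\<close>

lemma linearize_prod_Var_mult:
  fixes I :: "'v::finite set"
  shows "linearize y ((\<Prod>i\<in>I. Var i) * Var p) = lin_mon y (insert p I)"
  unfolding prod_Var by (simp add: Var_def mult_single linearize_single keys_sum_single keys_add_nat del: One_nat_def)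

lemma linearize_prod_Var_mult2:
  fixes I :: "'v::finite set"
  shows "linearize y ((\<Prod>i\<in>I. Var i) * (Var p * Var q)) = lin_mon y (insert p (insert q I))"
  unfolding prod_Var by (simp add: Var_def mult_single linearize_single keys_sum_single keys_add_nat insert_commute del: One_nat_def)

text \<open>Tracks which values of \<open>y\<close> a linearization can read. The nonnegativity
  constraint for \<open>I\<close> and \<open>J\<close> will read \<open>y\<close> on subsets of
  \<open>J\<close> only, so that \<open>y\<close> may be altered on larger sets.\<close>

definition mono_supp :: "'v set \<Rightarrow> 'v mpoly \<Rightarrow> bool" where
  "mono_supp J p \<longleftrightarrow> (\<forall>m\<in>Poly_Mapping.keys p. Poly_Mapping.keys m \<subseteq> J)"

lemma mono_supp_mult: "mono_supp J p \<Longrightarrow> mono_supp J q \<Longrightarrow> mono_supp J (p * q)"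
  unfolding mono_supp_def using keys_mult[of p q] by (fastforce simp: keys_add_nat)

lemma mono_supp_1 [simp]: "mono_supp J 1"
  by (simp add: mono_supp_def)

lemma mono_supp_diff: "mono_supp J p \<Longrightarrow> mono_supp J q \<Longrightarrow> mono_supp J (p - q)"
  unfolding mono_supp_def using keys_diff[of p q] by blast

lemma mono_supp_Var: "i \<in> J \<Longrightarrow> mono_supp J (Var i)"
  by (auto simp: mono_supp_def Var_def)

lemma mono_supp_prod: "(\<And>i. i \<in> A \<Longrightarrow> mono_supp J (f i)) \<Longrightarrow> mono_supp J (prod f A)"
  by (induction A rule: infinite_finite_induct) (auto intro: mono_supp_mult)

lemma mono_supp_SA_factor: "I \<subseteq> J \<Longrightarrow> mono_supp J (SA_factor I J)"
  unfolding SA_factor_def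
  by (intro mono_supp_mult mono_supp_prod mono_supp_diff mono_supp_1 mono_supp_Var) auto

lemma linearize_SA_factor_cong:
  assumes "I \<subseteq> J" "\<And>K. K \<subseteq> J \<Longrightarrow> y K = y' K"
  shows "linearize y (SA_factor I J) = linearize y' (SA_factor I J)"
  by (rule linearize_cong) (use assms mono_supp_SA_factor[of I J] in \<open>auto simp: mono_supp_def\<close>)

section \<open>The constraints in coordinates\<close>

definition SA_nonneg :: "('v set \<Rightarrow> real) \<Rightarrow> nat \<Rightarrow> bool" where
  "SA_nonneg y k \<longleftrightarrow> (\<forall>I J. I \<subseteq> J \<and> card J \<le> k \<longrightarrow> linearize y (SA_factor I J) \<ge> 0)"

definition DS_lin :: "(('n::finite \<times> 'n) set \<Rightarrow> real) \<Rightarrow> ('n \<times> 'n) set \<Rightarrow> bool" where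
  "DS_lin y I \<longleftrightarrow> (\<forall>u. (\<Sum>v\<in>UNIV. lin_mon y (insert (u, v) I)) = lin_mon y I) \<and>
                 (\<forall>v. (\<Sum>u\<in>UNIV. lin_mon y (insert (u, v) I)) = lin_mon y I)"

definition adj_lin ::
  "'n set set \<Rightarrow> 'n set set \<Rightarrow> (('n::finite \<times> 'n) set \<Rightarrow> real) \<Rightarrow> ('n \<times> 'n) set \<Rightarrow> bool" where
  "adj_lin G H y I \<longleftrightarrow>
    (\<forall>u v. (\<Sum>w | {u, w} \<in> G. lin_mon y (insert (w, v) I)) =
           (\<Sum>w | {w, v} \<in> H. lin_mon y (insert (u, w) I)))"

text \<open>The two families of quadratic equations together cover exactly the pairs of entries on
  which \<open>G\<close> and \<open>H\<close> disagree, hence the single condition with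
  \<open>\<noteq>\<close>.\<close>

definition quad_lin ::
  "'n set set \<Rightarrow> 'n set set \<Rightarrow> (('n::finite \<times> 'n) set \<Rightarrow> real) \<Rightarrow> ('n \<times> 'n) set \<Rightarrow> bool" where
  "quad_lin G H y I \<longleftrightarrow>
    (\<forall>u1 v1 u2 v2. ({u1, u2} \<in> G) \<noteq> ({v1, v2} \<in> H) \<longrightarrow>
       lin_mon y (insert (u1, v1) (insert (u2, v2) I)) = 0)"

text \<open>Choosing \<open>J = I\<close> leaves no complementary factors, only the monomial
  itself.\<close>

lemma SA_nonneg_lin_mon:
  fixes y :: "'v::finite set \<Rightarrow> real"
  assumes "SA_nonneg y k" "card I \<le> k"
  shows "lin_mon y I \<ge> 0"
proof -
  have "linearize y (SA_factor I I) \<ge> 0"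
    using assms unfolding SA_nonneg_def by blast
  then show ?thesis by (simp add: SA_factor_def linearize_prod_Var)
qed

lemma linearize_row:
  "linearize y ((\<Prod>i\<in>I. Var i) * ((XX *v vec 1) $ u - 1)) =
     (\<Sum>v\<in>UNIV. lin_mon y (insert (u, v) I)) - lin_mon y I"
  by (simp add: matrix_vector_mult_def XX_def right_diff_distrib linearize_diff
      linearize_prod_Var sum_distrib_left linearize_sum linearize_prod_Var_mult)

lemma linearize_column:
  "linearize y ((\<Prod>i\<in>I. Var i) * ((transpose XX *v vec 1) $ v - 1)) =
     (\<Sum>u\<in>UNIV. lin_mon y (insert (u, v) I)) - lin_mon y I"
  by (simp add: matrix_vector_mult_def XX_def transpose_def right_diff_distrib linearize_diff
      linearize_prod_Var sum_distrib_left linearize_sum linearize_prod_Var_mult)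

lemma linearize_adjacency:
  "linearize y ((\<Prod>i\<in>I. Var i) * (adj_matrix G ** XX - XX ** adj_matrix H) $ u $ v) =
     (\<Sum>w | {u, w} \<in> G. lin_mon y (insert (w, v) I)) -
     (\<Sum>w | {w, v} \<in> H. lin_mon y (insert (u, w) I))"
proof -
  have 1: "(adj_matrix G ** XX) $ u $ v = (\<Sum>w | {u, w} \<in> G. Var (w, v))"
    by (simp add: matrix_matrix_mult_def adj_matrix_def XX_def sum.inter_filter [symmetric]
        if_distrib [of "\<lambda>x. x * _"] cong: if_cong)
  have 2: "(XX ** adj_matrix H) $ u $ v = (\<Sum>w | {w, v} \<in> H. Var (u, w))"
    by (simp add: matrix_matrix_mult_def adj_matrix_def XX_def sum.inter_filter [symmetric]
        if_distrib [of "\<lambda>x. _ * x"] cong: if_cong)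
  show ?thesis
    by (simp add: 1 2 right_diff_distrib linearize_diff sum_distrib_left linearize_sum
        linearize_prod_Var_mult)
qed

lemma doubly_stochastic_lin_iff:
  "(\<forall>f\<in>doubly_stochastic_eqs. linearize y ((\<Prod>i\<in>I. Var i) * f) = 0) \<longleftrightarrow> DS_lin y I"
proof -
  have "(\<forall>f\<in>doubly_stochastic_eqs. linearize y ((\<Prod>i\<in>I. Var i) * f) = 0) \<longleftrightarrow>
        (\<forall>u. linearize y ((\<Prod>i\<in>I. Var i) * ((XX *v vec 1) $ u - 1)) = 0) \<and>
        (\<forall>v. linearize y ((\<Prod>i\<in>I. Var i) * ((transpose XX *v vec 1) $ v - 1)) = 0)"
    unfolding doubly_stochastic_eqs_def by blast
  then show ?thesis
    by (simp only: linearize_row linearize_column DS_lin_def right_minus_eq)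
qed

lemma T_eqs_lin_iff:
  "(\<forall>f\<in>T_eqs G H. linearize y ((\<Prod>i\<in>I. Var i) * f) = 0) \<longleftrightarrow> DS_lin y I \<and> adj_lin G H y I"
proof -
  have "(\<forall>f\<in>{(adj_matrix G ** XX - XX ** adj_matrix H) $ u $ v | u v. True}.
           linearize y ((\<Prod>i\<in>I. Var i) * f) = 0) \<longleftrightarrow>
        (\<forall>u v. linearize y ((\<Prod>i\<in>I. Var i) *
           (adj_matrix G ** XX - XX ** adj_matrix H) $ u $ v) = 0)"
    by blast
  also have "\<dots> \<longleftrightarrow> adj_lin G H y I"
    by (simp only: linearize_adjacency adj_lin_def right_minus_eq)
  finally show ?thesis
    by (simp only: T_eqs_def ball_Un doubly_stochastic_lin_iff)
qed

lemma Q_eqs_lin_iff: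
  "(\<forall>f\<in>Q_eqs G H. linearize y ((\<Prod>i\<in>I. Var i) * f) = 0) \<longleftrightarrow> DS_lin y I \<and> quad_lin G H y I"
proof -
  have XX: "XX $ u $ v = Var (u, v)" for u v :: 'a
    by (simp add: XX_def)
  have "(\<forall>f\<in>{XX $ u1 $ v1 * XX $ u2 $ v2 | u1 v1 u2 v2. P u1 v1 u2 v2}.
           linearize y ((\<Prod>i\<in>I. Var i) * f) = 0) \<longleftrightarrow>
        (\<forall>u1 v1 u2 v2. P u1 v1 u2 v2 \<longrightarrow> lin_mon y (insert (u1, v1) (insert (u2, v2) I)) = 0)"
    for P
    unfolding XX linearize_prod_Var_mult2 [symmetric] by blast
  then show ?thesis
    by (simp only: Q_eqs_def ball_Un doubly_stochastic_lin_iff quad_lin_def) blast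
qed

lemma mem_T_relaxation_iff:
  "X \<in> T_relaxation k G H \<longleftrightarrow>
    (\<exists>y. (\<forall>I. card I \<le> k - 1 \<longrightarrow> DS_lin y I \<and> adj_lin G H y I) \<and> SA_nonneg y k \<and>
         (\<forall>i. flatten X $ i = y {i}))"
  unfolding T_relaxation_def SA_relaxation_def SA_polyhedron_def SA_nonneg_def
    T_eqs_lin_iff [symmetric] by auto

lemma mem_Q_relaxation_iff:
  "X \<in> Q_relaxation k G H \<longleftrightarrow>
    (\<exists>y. (\<forall>I. card I \<le> k - 1 \<longrightarrow> DS_lin y I \<and> quad_lin G H y I) \<and> SA_nonneg y k \<and>
         (\<forall>i. flatten X $ i = y {i}))"
  unfolding Q_relaxation_def SA_relaxation_def SA_polyhedron_def SA_nonneg_def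
    Q_eqs_lin_iff [symmetric] by auto

section \<open>The inclusions\<close>

lemma quad_lin_imp_adj_lin:
  assumes "\<And>p. DS_lin y (insert p I)" and Q: "quad_lin G H y I"
  shows "adj_lin G H y I"
  unfolding adj_lin_def
proof (intro allI)
  fix u v
  have row: "lin_mon y (insert (w, v) I) =
      (\<Sum>x | {x, v} \<in> H. lin_mon y (insert (u, x) (insert (w, v) I)))" if "{u, w} \<in> G" for w
  proof -
    \<comment> \<open>The row equation of \<open>u\<close> is multiplied by a monomial with possibly
      one factor more than \<open>I\<close>; this costs one level of the hierarchy.\<close>
    have "lin_mon y (insert (w, v) I) = (\<Sum>x\<in>UNIV. lin_mon y (insert (u, x) (insert (w, v) I)))"
      using assms(1) unfolding DS_lin_def by simp
    also have "\<dots> = (\<Sum>x | {x, v} \<in> H. lin_mon y (insert (u, x) (insert (w, v) I)))"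
      by (rule sum.mono_neutral_right) (use Q that in \<open>auto simp: quad_lin_def\<close>)
    finally show ?thesis .
  qed
  have column: "lin_mon y (insert (u, x) I) =
      (\<Sum>w | {u, w} \<in> G. lin_mon y (insert (u, x) (insert (w, v) I)))" if "{x, v} \<in> H" for x
  proof -
    have "lin_mon y (insert (u, x) I) = (\<Sum>w\<in>UNIV. lin_mon y (insert (w, v) (insert (u, x) I)))"
      using assms(1) unfolding DS_lin_def by simp
    \<comment> \<open>Reordered to match the summand in \<open>row\<close>, so that the two double
      sums differ only in the order of summation.\<close>
    also have "\<dots> = (\<Sum>w\<in>UNIV. lin_mon y (insert (u, x) (insert (w, v) I)))"
      by (simp add: insert_commute)
    also have "\<dots> = (\<Sum>w | {u, w} \<in> G. lin_mon y (insert (u, x) (insert (w, v) I)))"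
      by (rule sum.mono_neutral_right) (use Q that in \<open>auto simp: quad_lin_def\<close>)
    finally show ?thesis .
  qed
  have "(\<Sum>w | {u, w} \<in> G. lin_mon y (insert (w, v) I)) =
      (\<Sum>w | {u, w} \<in> G. \<Sum>x | {x, v} \<in> H. lin_mon y (insert (u, x) (insert (w, v) I)))"
    by (rule sum.cong) (auto simp: row)
  also have "\<dots> = (\<Sum>x | {x, v} \<in> H. \<Sum>w | {u, w} \<in> G. lin_mon y (insert (u, x) (insert (w, v) I)))"
    by (rule sum.swap)
  also have "\<dots> = (\<Sum>x | {x, v} \<in> H. lin_mon y (insert (u, x) I))"
    by (rule sum.cong) (auto simp: column)
  finally show "(\<Sum>w | {u, w} \<in> G. lin_mon y (insert (w, v) I)) =
      (\<Sum>w | {w, v} \<in> H. lin_mon y (insert (u, w) I))" .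
qed

lemma Q_relaxation_subset_T_relaxation:
  assumes "k \<ge> 1"
  shows "Q_relaxation (k + 1) G H \<subseteq> T_relaxation k G H"
proof
  fix X assume "X \<in> Q_relaxation (k + 1) G H"
  then obtain y where y: "\<And>I. card I \<le> k \<Longrightarrow> DS_lin y I \<and> quad_lin G H y I"
      "SA_nonneg y (k + 1)" "\<forall>i. flatten X $ i = y {i}"
    unfolding mem_Q_relaxation_iff by auto
  have "DS_lin y I \<and> adj_lin G H y I" if "card I \<le> k - 1" for I
  proof -
    \<comment> \<open>Level \<open>k + 1\<close> admits multipliers of degree up to
      \<open>k\<close>. As subtraction is truncated, \<open>k \<ge> 1\<close> is what makes
      \<open>k - 1\<close> leave room for \<open>p\<close>.\<close>
    have "card (insert p I) \<le> k" for p
      using card_insert_le_m1[of k I p] that assms by simp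
    then show ?thesis using y(1) that by (auto intro!: quad_lin_imp_adj_lin)
  qed
  moreover have "SA_nonneg y k" using y(2) by (auto simp: SA_nonneg_def)
  ultimately show "X \<in> T_relaxation k G H" unfolding mem_T_relaxation_iff using y(3) by blast
qed

section \<open>From adjacency equations to quadratic equations\<close>

lemma sum_eq_member_imp_0:
  fixes f :: "'a \<Rightarrow> 'b::ordered_ab_group_add"
  assumes "finite A" "sum f A = f a" "a \<in> A" "b \<in> A" "b \<noteq> a" "\<And>x. x \<in> A \<Longrightarrow> f x \<ge> 0"
  shows "f b = 0"
proof -
  have "sum f (A - {a}) = 0"
    using assms(1-3) by (simp add: sum_diff1)
  then show ?thesis
    using assms by (subst (asm) sum_nonneg_eq_0_iff) auto
qed

text \<open>As \<open>(u, v) \<in> I\<close>, the summand at \<open>v\<close> is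
  \<open>lin_mon y I\<close> by absorption, which already exhausts the row sum.\<close>

lemma DS_lin_row_0:
  assumes "DS_lin y I" "\<And>p. lin_mon y (insert p I) \<ge> 0" "(u, v) \<in> I" "w \<noteq> v"
  shows "lin_mon y (insert (u, w) I) = 0"
  by (rule sum_eq_member_imp_0 [of UNIV "\<lambda>w. lin_mon y (insert (u, w) I)" v])
    (use assms in \<open>auto simp: DS_lin_def insert_absorb\<close>)

lemma DS_lin_column_0:
  assumes "DS_lin y I" "\<And>p. lin_mon y (insert p I) \<ge> 0" "(u, v) \<in> I" "w \<noteq> u"
  shows "lin_mon y (insert (w, v) I) = 0"
  by (rule sum_eq_member_imp_0 [of UNIV "\<lambda>w. lin_mon y (insert (w, v) I)" u])
    (use assms in \<open>auto simp: DS_lin_def insert_absorb\<close>)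

lemma adj_lin_conflict_0:
  assumes DS: "DS_lin y I" and A: "adj_lin G H y I"
    and nonneg: "\<And>p. lin_mon y (insert p I) \<ge> 0"
    and mem: "(u1, v1) \<in> I" and conflict: "({u1, u2} \<in> G) \<noteq> ({v1, v2} \<in> H)"
  shows "lin_mon y (insert (u2, v2) I) = 0"
proof (cases "{u1, u2} \<in> G")
  case True
  then have "{v1, v2} \<notin> H" using conflict by simp
  \<comment> \<open>Every such \<open>w\<close> differs from \<open>v1\<close>, so its entry shares
    row \<open>u1\<close> with \<open>(u1, v1)\<close>. This is one side of the adjacency equation
    at \<open>(u1, v2)\<close>; the other contains the wanted term.\<close>
  then have "(\<Sum>w | {w, v2} \<in> H. lin_mon y (insert (u1, w) I)) = 0"
    by (intro sum.neutral) (auto intro!: DS_lin_row_0 [OF DS nonneg mem])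
  then have "(\<Sum>w | {u1, w} \<in> G. lin_mon y (insert (w, v2) I)) = 0"
    using A unfolding adj_lin_def by simp
  then show ?thesis using True nonneg by (subst (asm) sum_nonneg_eq_0_iff) auto
next
  case False
  then have H: "{v2, v1} \<in> H" using conflict by (simp add: insert_commute)
  \<comment> \<open>Dually, \<open>w\<close> differs from \<open>u1\<close>, and column
    \<open>v1\<close> with the equation at \<open>(u2, v1)\<close> is used.\<close>
  have "(\<Sum>w | {u2, w} \<in> G. lin_mon y (insert (w, v1) I)) = 0"
    using False
    by (intro sum.neutral) (auto simp: insert_commute intro!: DS_lin_column_0 [OF DS nonneg mem])
  then have "(\<Sum>w | {w, v1} \<in> H. lin_mon y (insert (u2, w) I)) = 0"
    using A unfolding adj_lin_def by simp
  then show ?thesis using H nonneg by (subst (asm) sum_nonneg_eq_0_iff) auto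
qed

lemma T_relaxation_subset_Q_relaxation:
  assumes "simple_graph G" "simple_graph H" "k \<ge> 1"
  shows "T_relaxation k G H \<subseteq> Q_relaxation k G H"
proof
  fix X assume "X \<in> T_relaxation k G H"
  then obtain y where y: "\<And>I. card I \<le> k - 1 \<Longrightarrow> DS_lin y I \<and> adj_lin G H y I"
      "SA_nonneg y k" "\<forall>i. flatten X $ i = y {i}"
    unfolding mem_T_relaxation_iff by auto
  \<comment> \<open>Quadratic equations times a monomial of degree \<open>k - 1\<close> reach degree
    \<open>k + 1\<close>; everything else lives in degree at most \<open>k\<close>, where
    \<open>y'\<close> agrees with \<open>y\<close>.\<close>
  define y' where "y' I = (if card I \<le> k then y I else 0)" for I
  have lin: "lin_mon y' I = (if card I \<le> k then lin_mon y I else 0)" for I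
    by (simp add: lin_mon_def y'_def)
  have card_insert: "card (insert p I) \<le> k" if "card I \<le> k - 1"
    for p and I :: "('a \<times> 'a) set"
    using card_insert_le_m1[of k I p] that assms(3) by simp
  have DS: "DS_lin y' I" if "card I \<le> k - 1" for I
    using y(1)[OF that] card_insert[OF that] that by (simp add: DS_lin_def lin)
  have quad: "quad_lin G H y' I" for I
    unfolding quad_lin_def
  proof (intro allI impI)
    fix u1 v1 u2 v2 assume conflict: "({u1, u2} \<in> G) \<noteq> ({v1, v2} \<in> H)"
    have loop: "{u, u} \<notin> E" if "simple_graph E" for u :: 'a and E
      using that by (fastforce simp: simple_graph_def doubleton_eq_iff)
    let ?J = "insert (u1, v1) (insert (u2, v2) I)"
    \<comment> \<open>Without loops, equal entries give a non-edge in both graphs and hence no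
      conflict.\<close>
    have ne: "(u1, v1) \<noteq> (u2, v2)" using conflict loop assms(1,2) by auto
    show "lin_mon y' ?J = 0"
    proof (cases "card ?J \<le> k")
      case True
      \<comment> \<open>\<open>?K\<close> replaces \<open>I\<close> as the multiplier: it contains
        \<open>(u1, v1)\<close> and has at most \<open>k - 1\<close> elements, even if
        \<open>I\<close> already contains one of the two entries.\<close>
      let ?K = "?J - {(u2, v2)}"
      have K: "card ?K \<le> k - 1" using True by simp
      have "lin_mon y (insert (u2, v2) ?K) = 0"
      proof (rule adj_lin_conflict_0)
        show "lin_mon y (insert p ?K) \<ge> 0" for p
          using SA_nonneg_lin_mon[OF y(2)] card_insert[OF K] by blast
        show "(u1, v1) \<in> ?K" using ne by simp
      qed (use y(1)[OF K] conflict in auto)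
      moreover have "insert (u2, v2) ?K = ?J" by blast
      ultimately show ?thesis by (simp add: lin)
    qed (simp add: lin)
  qed
  have "SA_nonneg y' k"
    unfolding SA_nonneg_def
  proof (intro allI impI)
    fix I J :: "('a \<times> 'a) set" assume *: "I \<subseteq> J \<and> card J \<le> k"
    have "linearize y' (SA_factor I J) = linearize y (SA_factor I J)"
    proof (rule linearize_SA_factor_cong)
      fix K assume "K \<subseteq> J"
      then have "card K \<le> card J" by (intro card_mono) auto
      then show "y' K = y K" using * by (simp add: y'_def)
    qed (use * in simp)
    then show "linearize y' (SA_factor I J) \<ge> 0"
      using y(2) * by (simp add: SA_nonneg_def)
  qed
  \<comment> \<open>Singletons survive the truncation because \<open>k \<ge> 1\<close>.\<close>
  moreover have "\<forall>i. flatten X $ i = y' {i}" using y(3) assms(3) by (simp add: y'_def)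
  ultimately show "X \<in> Q_relaxation k G H"
    unfolding mem_Q_relaxation_iff using DS quad by blast
qed

theorem lemma1p3:
  fixes G H :: "('n::finite) set set" and k :: nat
  assumes "simple_graph G" and "simple_graph H" and "k \<ge> 1"
  shows "Q_relaxation (k + 1) G H \<subseteq> T_relaxation k G H \<and>
         T_relaxation k G H \<subseteq> Q_relaxation k G H \<and>
         Q_relaxation (k + 1) G G \<subseteq> T_relaxation k G G \<and>
         T_relaxation k G G \<subseteq> Q_relaxation k G G"
  using assms Q_relaxation_subset_T_relaxation T_relaxation_subset_Q_relaxation by blast

end
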